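(* For every integer $n \geq 15$ there exists a Hamiltonian chordal graph on $n$ vertices that is not fully cycle extendable.
   Context: All graphs are finite, simple and undirected. A graph is chordal if it has no induced cycle of length $4$ or more. A graph is Hamiltonian if it has a cycle through all its vertices. If $C$ is a cycle of length $m$ in a graph $G$, an extension of $C$ is a cycle $C'$ of length $m+1$ with $V(C')\setminus V(C)=\{v\}$ for a single vertex $v$; $C$ is extendable if it has an extension. $G$ is cycle extendable if every non-Hamiltonian cycle of $G$ is extendable, and fully cycle extendable if in addition every vertex of $G$ lies on a triangle. (Hendry's Conjecture asserted that every Hamiltonian chordal graph is fully cycle extendable.) *)

theory Defs
  imports "Graph_Theory.Graph_Theory"
begin

text \<open>
  Finite simple undirected graphs are the locale \<^locale>\<open>pair_graph\<close>: finite, loop-free, symmetric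
  digraphs whose arcs are pairs of vertices. Each undirected edge is the pair of arcs (u,v), (v,u).
\<close>

text \<open>
  A cycle is given by the list of arcs met when traversing it once. The library notion admits the
  closed walk u, v, u in a symmetric digraph, which is not a cycle of an undirected graph; this is
  excluded by the bound on the length.
\<close>

definition ugraph_cycle :: "'a pair_pre_digraph \<Rightarrow> ('a \<times> 'a) list \<Rightarrow> bool" where
  "ugraph_cycle G C \<longleftrightarrow> pre_digraph.cycle (with_proj G) C \<and> 3 \<le> length C"

definition cycle_verts :: "('a \<times> 'a) list \<Rightarrow> 'a set" where
  "cycle_verts C = fst ` set C"

text \<open>The subgraph of G induced by the vertices of C has no edges besides those of C.\<close>

definition induced_cycle :: "'a pair_pre_digraph \<Rightarrow> ('a \<times> 'a) list \<Rightarrow> bool" where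
  "induced_cycle G C \<longleftrightarrow>
     ugraph_cycle G C \<and> arcs (with_proj G \<restriction> cycle_verts C) = set C \<union> (set C)\<inverse>"

definition chordal :: "'a pair_pre_digraph \<Rightarrow> bool" where
  "chordal G \<longleftrightarrow> \<not> (\<exists>C. induced_cycle G C \<and> 4 \<le> length C)"

definition hamiltonian_cycle :: "'a pair_pre_digraph \<Rightarrow> ('a \<times> 'a) list \<Rightarrow> bool" where
  "hamiltonian_cycle G C \<longleftrightarrow> ugraph_cycle G C \<and> cycle_verts C = pverts G"

definition hamiltonian :: "'a pair_pre_digraph \<Rightarrow> bool" where
  "hamiltonian G \<longleftrightarrow> (\<exists>C. hamiltonian_cycle G C)"

definition cycle_extension ::
    "'a pair_pre_digraph \<Rightarrow> ('a \<times> 'a) list \<Rightarrow> ('a \<times> 'a) list \<Rightarrow> bool" where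
  "cycle_extension G C C' \<longleftrightarrow>
     ugraph_cycle G C' \<and> length C' = length C + 1 \<and> (\<exists>v. cycle_verts C' - cycle_verts C = {v})"

definition extendable :: "'a pair_pre_digraph \<Rightarrow> ('a \<times> 'a) list \<Rightarrow> bool" where
  "extendable G C \<longleftrightarrow> (\<exists>C'. cycle_extension G C C')"

definition cycle_extendable :: "'a pair_pre_digraph \<Rightarrow> bool" where
  "cycle_extendable G \<longleftrightarrow>
     (\<forall>C. ugraph_cycle G C \<and> \<not> hamiltonian_cycle G C \<longrightarrow> extendable G C)"

definition fully_cycle_extendable :: "'a pair_pre_digraph \<Rightarrow> bool" where
  "fully_cycle_extendable G \<longleftrightarrow> cycle_extendable G \<and>
     (\<forall>v \<in> pverts G. \<exists>C. ugraph_cycle G C \<and> length C = 3 \<and> v \<in> cycle_verts C)"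

end

theory Submission
  imports Defs
begin

text \<open>
  The numbering of the vertices is a perfect elimination ordering, so the graph is chordal: in an
  induced cycle the two neighbours of the largest vertex would be adjacent. The graph is a core on
  0, ..., 9 with triangles pasted on the edges 27, 49, 14, 03, 38, the last one extended by a fan with
  centre 3 to reach n vertices; the pasted vertices of degree 2 force edges of every cycle through
  them. There is a cycle missing exactly 5 and 6. A cycle extending it has all edges at 3 and 4
  forced. If it contains 6, it must pass through 2, 6, 7 and close up there with 10; if it contains 5,
  it must use 1, 5, 2 and 11, 9, 8, 14, after which only one edge is left at 7.
\<close>

section \<open>Cycles as lists of distinct vertices\<close>

lemma cas_with_proj_iff:
  "pre_digraph.cas (with_proj G) u C v \<longleftrightarrow> u # map snd C = map fst C @ [v]"
  by (induction C arbitrary: u) (auto simp: pre_digraph.cas.simps)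

lemma awalk_verts_with_proj:
  "pre_digraph.awalk_verts (with_proj G) u C = (if C = [] then [u] else map fst C @ [snd (last C)])"
  by (induction C arbitrary: u) (auto simp: pre_digraph.awalk_verts.simps)

text \<open>Each arc ends where the next one starts, cyclically, so the targets are the sources
  rotated by one. The sources alone thus determine the cycle, and indices modulo the length become
  available.\<close>

lemma ugraph_cycle_iff:
  assumes "pair_wf_digraph G"
  shows "ugraph_cycle G C \<longleftrightarrow>
    (\<exists>vs. C = zip vs (rotate1 vs) \<and> distinct vs \<and> 3 \<le> length vs \<and> set C \<subseteq> parcs G)"
proof
  assume "ugraph_cycle G C"
  then obtain u where len: "3 \<le> length C" and arcs: "set C \<subseteq> parcs G"
    and cas: "u # map snd C = map fst C @ [u]"
    and dist: "distinct (tl (pre_digraph.awalk_verts (with_proj G) u C))"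
    by (auto simp: ugraph_cycle_def pre_digraph.cycle_def pre_digraph.awalk_def cas_with_proj_iff)
  from len obtain e es where C: "C = e # es"
    by (cases C) auto
  have snd: "map snd C = rotate1 (map fst C)"
    using cas C by auto
  have "last (u # map snd C) = u"
    using cas by simp
  then have "snd (last C) = u"
    using C by (auto simp: last_map split: if_splits)
  then have "pre_digraph.awalk_verts (with_proj G) u C = u # map snd C"
    using C cas by (simp add: awalk_verts_with_proj)
  then have "tl (pre_digraph.awalk_verts (with_proj G) u C) = map snd C"
    by simp
  then have "distinct (map fst C)"
    using dist snd by simp
  moreover have "C = zip (map fst C) (rotate1 (map fst C))"
    by (metis snd zip_map_fst_snd)
  ultimately show "\<exists>vs. C = zip vs (rotate1 vs) \<and> distinct vs \<and> 3 \<le> length vs \<and> set C \<subseteq> parcs G"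
    using len arcs by (intro exI[of _ "map fst C"]) auto
next
  assume "\<exists>vs. C = zip vs (rotate1 vs) \<and> distinct vs \<and> 3 \<le> length vs \<and> set C \<subseteq> parcs G"
  then obtain vs where C: "C = zip vs (rotate1 vs)" and dist: "distinct vs"
    and len: "3 \<le> length vs" and arcs: "set C \<subseteq> parcs G"
    by blast
  obtain u us where vs: "vs = u # us"
    using len by (cases vs) auto
  have fst: "map fst C = vs" and snd: "map snd C = us @ [u]"
    using C vs by simp_all
  have "C \<noteq> []"
    using C vs by auto
  then have "pre_digraph.awalk_verts (with_proj G) u C = vs @ [u]"
    using fst snd by (metis awalk_verts_with_proj last_map last_snoc)
  moreover have "u \<in> pverts G"
    using arcs C vs assms by (cases us) (auto dest: pair_wf_digraph.arc_fst_in_verts)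
  ultimately show "ugraph_cycle G C"
    using arcs dist len C vs fst snd \<open>C \<noteq> []\<close>
    by (auto simp: ugraph_cycle_def pre_digraph.cycle_def pre_digraph.awalk_def cas_with_proj_iff
        intro!: exI[of _ u])
qed

section \<open>Neighbours along a cycle, regardless of its direction\<close>

definition cycle_nbrs :: "('a \<times> 'a) list \<Rightarrow> 'a \<Rightarrow> 'a set" where
  "cycle_nbrs C v = {u. (v, u) \<in> set C \<or> (u, v) \<in> set C}"

lemma cycle_verts_zip [simp]: "cycle_verts (zip vs (rotate1 vs)) = set vs"
  by (metis cycle_verts_def length_rotate1 list.set_map map_fst_zip)

lemma set_zip_rotate1:
  "set (zip vs (rotate1 vs)) = {(vs ! i, vs ! (Suc i mod length vs)) | i. i < length vs}"
  by (auto simp: set_zip nth_rotate1)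

context
  fixes G :: "'a pair_pre_digraph" and C :: "('a \<times> 'a) list"
  assumes wf: "pair_wf_digraph G" and cyc: "ugraph_cycle G C"
begin

lemma card_cycle_verts: "card (cycle_verts C) = length C"
  using cyc by (auto simp: ugraph_cycle_iff[OF wf] distinct_card)

lemma card_cycle_nbrs:
  assumes "v \<in> cycle_verts C"
  shows "card (cycle_nbrs C v) = 2"
proof -
  obtain vs where C: "C = zip vs (rotate1 vs)" and dist: "distinct vs" and len: "3 \<le> length vs"
    using cyc by (auto simp: ugraph_cycle_iff[OF wf])
  let ?m = "length vs"
  have "v \<in> set vs"
    using assms C by simp
  then obtain i where i: "i < ?m" "v = vs ! i"
    by (auto simp: in_set_conv_nth)
  \<comment> \<open>Cyclic predecessor and successor of position \<open>i\<close>. They differ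
    because the length is at least 3; for a closed walk u, v, u they would coincide.\<close>
  define p where "p = (if i = 0 then ?m - 1 else i - 1)"
  define s where "s = Suc i mod ?m"
  have p: "p < ?m" "Suc j mod ?m = i \<longleftrightarrow> j = p" if "j < ?m" for j
    using that i len by (auto simp: p_def mod_Suc)
  have p': "p < ?m" and s: "s < ?m" and "p \<noteq> s"
    using i len by (auto simp: p_def s_def mod_Suc)
  have "cycle_nbrs C v = {vs ! s, vs ! p}"
  proof (intro set_eqI iffI)
    fix u assume "u \<in> cycle_nbrs C v"
    then consider j where "j < ?m" "v = vs ! j" "u = vs ! (Suc j mod ?m)"
      | j where "j < ?m" "u = vs ! j" "v = vs ! (Suc j mod ?m)"
      by (auto simp: cycle_nbrs_def C set_zip_rotate1)
    then show "u \<in> {vs ! s, vs ! p}"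
    proof cases
      case 1
      then show ?thesis
        using i dist by (auto simp: s_def nth_eq_iff_index_eq)
    next
      case 2
      then have "Suc j mod ?m = i"
        using i dist by (metis mod_less_divisor not_less_zero nth_eq_iff_index_eq gr_zeroI)
      then show ?thesis
        using p 2 by auto
    qed
  next
    fix u assume "u \<in> {vs ! s, vs ! p}"
    moreover have "Suc p mod ?m = i"
      using p p' by auto
    ultimately show "u \<in> cycle_nbrs C v"
      using i p' unfolding cycle_nbrs_def C set_zip_rotate1 s_def by blast
  qed
  moreover have "vs ! s \<noteq> vs ! p"
    using p' s \<open>p \<noteq> s\<close> dist by (simp add: nth_eq_iff_index_eq)
  ultimately show ?thesis
    by simp
qed

lemma cycle_nbrs_subset: "cycle_nbrs C v \<subseteq> cycle_verts C"
proof -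
  obtain vs where C: "C = zip vs (rotate1 vs)"
    using cyc by (auto simp: ugraph_cycle_iff[OF wf])
  then show ?thesis
    by (auto simp: cycle_nbrs_def dest: set_zip_leftD set_zip_rightD)
qed

lemma cycle_nbrs_arcs: "u \<in> cycle_nbrs C v \<Longrightarrow> (u, v) \<in> parcs G \<or> (v, u) \<in> parcs G"
  using cyc by (auto simp: cycle_nbrs_def ugraph_cycle_iff[OF wf])

lemma cycle_verts_subset_pverts: "cycle_verts C \<subseteq> pverts G"
proof -
  have "set C \<subseteq> parcs G"
    using cyc by (auto simp: ugraph_cycle_iff[OF wf])
  then show ?thesis
    using wf by (force simp: cycle_verts_def pair_wf_digraph_def)
qed

text \<open>A cycle is connected: walking along it from \<open>v\<close> never leaves
  \<open>S\<close> and reaches every vertex. This rules out cycles that close up too early.\<close>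

lemma cycle_verts_subset_closed:
  assumes "v \<in> S" "v \<in> cycle_verts C" "\<And>u. u \<in> S \<Longrightarrow> cycle_nbrs C u \<subseteq> S"
  shows "cycle_verts C \<subseteq> S"
proof -
  obtain vs where C: "C = zip vs (rotate1 vs)" and len: "3 \<le> length vs"
    using cyc by (auto simp: ugraph_cycle_iff[OF wf])
  let ?m = "length vs"
  have "v \<in> set vs"
    using assms C by simp
  then obtain i where i: "i < ?m" "v = vs ! i"
    by (auto simp: in_set_conv_nth)
  have step: "vs ! ((i + k) mod ?m) \<in> S" for k
  proof (induction k)
    case 0
    then show ?case using i assms by simp
  next
    case (Suc k)
    have "vs ! (Suc ((i + k) mod ?m) mod ?m) \<in> cycle_nbrs C (vs ! ((i + k) mod ?m))"
    proof -
      have "(i + k) mod ?m < ?m"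
        using len by (intro mod_less_divisor) linarith
      then show ?thesis
        unfolding cycle_nbrs_def C set_zip_rotate1 by blast
    qed
    then show ?case
      using assms(3)[OF Suc] by (auto simp: mod_Suc_eq)
  qed
  have "vs ! j \<in> S" if "j < ?m" for j
    \<comment> \<open>With this offset, \<open>i + k\<close> becomes \<open>?m + j\<close>, which
      reduces to \<open>j\<close>, so no case split on the order of \<open>i\<close> and
      \<open>j\<close> arises.\<close>
    using step[of "?m - i + j"] i that by simp
  then show ?thesis
    by (auto simp: C in_set_conv_nth)
qed

text \<open>Forcing from above: when all but two candidates are excluded, both are used. Two
  neighbours have to fit into \<open>{x, y}\<close>, so \<open>x\<close> and \<open>y\<close> are
  automatically distinct.\<close>

lemma cycle_nbrs_eq:
  assumes "v \<in> cycle_verts C" "cycle_nbrs C v \<subseteq> {x, y}"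
  shows "cycle_nbrs C v = {x, y}"
proof (rule card_subset_eq)
  show "card (cycle_nbrs C v) = card {x, y}"
    using card_cycle_nbrs[OF assms(1)] card_mono[OF _ assms(2)] card_insert_le_m1[of 2 "{y}" x]
    by auto
qed (use assms in auto)

text \<open>Forcing from below: two known cycle edges saturate a vertex and exclude all its other
  edges.\<close>

lemma cycle_nbrs_eq':
  assumes "x \<in> cycle_nbrs C v" "y \<in> cycle_nbrs C v" "x \<noteq> y"
  shows "cycle_nbrs C v = {x, y}"
proof -
  have "v \<in> cycle_verts C"
    using assms(1) cycle_nbrs_subset[of x] by (auto simp: cycle_nbrs_def)
  then have "card (cycle_nbrs C v) = 2"
    by (rule card_cycle_nbrs)
  then have "finite (cycle_nbrs C v)" "card (cycle_nbrs C v) = card {x, y}"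
    using assms by (auto intro: card_ge_0_finite)
  then show ?thesis
    using assms card_subset_eq[of "cycle_nbrs C v" "{x, y}"] by auto
qed

end

lemma cycle_nbrs_sym: "u \<in> cycle_nbrs C v \<longleftrightarrow> v \<in> cycle_nbrs C u"
  by (auto simp: cycle_nbrs_def)

section \<open>Chordality from a perfect elimination ordering\<close>

lemma pair_wf_digraph_if_pair_graph: "pair_graph G \<Longrightarrow> pair_wf_digraph G"
  by (simp add: pair_graph_def pair_digraph_def pair_fin_digraph_def)

text \<open>The edge between the two neighbours of the largest vertex is itself an edge of the
  cycle, as the cycle is induced. These three vertices are then closed under cycle neighbours, so
  the cycle is a triangle.\<close>

lemma chordal_if_elimination_order:
  fixes G :: "'a::linorder pair_pre_digraph"
  assumes G: "pair_graph G"
    and clique: "\<And>u v w. (u, w) \<in> parcs G \<Longrightarrow> (v, w) \<in> parcs G \<Longrightarrow> u < w \<Longrightarrow> v < w \<Longrightarrow> u \<noteq> v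
      \<Longrightarrow> (u, v) \<in> parcs G"
  shows "chordal G"
  unfolding chordal_def
proof
  assume "\<exists>C. induced_cycle G C \<and> 4 \<le> length C"
  then obtain C where C: "ugraph_cycle G C" "4 \<le> length C"
    and ind: "arcs (with_proj G \<restriction> cycle_verts C) = set C \<union> (set C)\<inverse>"
    by (auto simp: induced_cycle_def)
  have wf: "pair_wf_digraph G"
    using G by (rule pair_wf_digraph_if_pair_graph)
  have sym: "(y, x) \<in> parcs G" if "(x, y) \<in> parcs G" for x y
    using that G pair_sym_digraph.arcs_symmetric[of G x y]
    by (simp add: pair_graph_def pair_pseudo_graph_def)
  have fin: "finite (cycle_verts C)" and "cycle_verts C \<noteq> {}"
    using C by (auto simp: cycle_verts_def)
  define w where "w = Max (cycle_verts C)"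
  have w: "w \<in> cycle_verts C"
    using fin \<open>cycle_verts C \<noteq> {}\<close> by (simp add: w_def)
  obtain u v where uv: "cycle_nbrs C w = {u, v}" "u \<noteq> v"
    using card_cycle_nbrs[OF wf C(1) w] by (auto simp: card_2_iff)
  have arc: "(x, y) \<in> parcs G" if "y \<in> cycle_nbrs C x" for x y
    using cycle_nbrs_arcs[OF wf C(1) that] sym by blast
  have le: "x < w" if "x \<in> cycle_nbrs C w" for x
  proof -
    have "x \<noteq> w"
      using arc[OF that] G pair_loopfree_digraph.no_loops'[of G]
      by (auto simp: pair_graph_def pair_digraph_def)
    then show ?thesis
      using that cycle_nbrs_subset[OF wf C(1)] fin by (force simp: w_def less_le)
  qed
  have verts: "u \<in> cycle_verts C" "v \<in> cycle_verts C"
    using uv cycle_nbrs_subset[OF wf C(1), of w] by auto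
  have wuv: "w \<in> cycle_nbrs C u" "w \<in> cycle_nbrs C v"
    using uv(1) cycle_nbrs_sym[of w C] by simp_all
  then have "(u, v) \<in> parcs G"
    using uv le by (intro clique[of u w v]) (auto intro: arc)
  then have "(u, v) \<in> set C \<union> (set C)\<inverse>"
    using verts unfolding ind[symmetric] by simp
  then have vu: "v \<in> cycle_nbrs C u" "u \<in> cycle_nbrs C v"
    by (auto simp: cycle_nbrs_def)
  have "w \<noteq> u" "w \<noteq> v"
    using uv le by auto
  then have "cycle_nbrs C u = {w, v}" "cycle_nbrs C v = {w, u}"
    using cycle_nbrs_eq'[OF wf C(1)] wuv vu by blast+
  then have "cycle_verts C \<subseteq> {u, v, w}"
    using uv(1) w by (intro cycle_verts_subset_closed[OF wf C(1), of w]) auto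
  then have "card (cycle_verts C) \<le> 3"
    using card_mono[of "{u, v, w}" "cycle_verts C"] card_insert_le_m1[of 3 "{v, w}" u]
      card_insert_le_m1[of 2 "{w}" v] by simp
  then show False
    using C card_cycle_verts[OF wf C(1)] by simp
qed

text \<open>In the form with \<open>successively\<close>, the condition splits along appends, which
  suits cycles with a symbolic middle segment.\<close>

lemma set_zip_rotate1_subset_iff:
  assumes "vs \<noteq> []"
  shows "set (zip vs (rotate1 vs)) \<subseteq> R \<longleftrightarrow> successively (\<lambda>x y. (x, y) \<in> R) (vs @ [hd vs])"
proof -
  have "set (zip xs (tl xs @ [y])) \<subseteq> R \<longleftrightarrow> successively (\<lambda>x y. (x, y) \<in> R) (xs @ [y])"
    for xs y
    by (induction xs rule: induct_list012) simp_all
  from this[of vs "hd vs"] show ?thesis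
    using assms by (simp add: rotate1_hd_tl)
qed

section \<open>The graph and its elimination ordering\<close>

definition core_arcs :: "(nat \<times> nat) list" where
  "core_arcs =
    [(0,1), (0,2), (1,2), (0,3), (1,3), (2,3), (1,4), (2,4), (3,4), (1,5), (2,5), (3,5), (4,5),
     (2,6), (3,6), (4,6), (5,6), (2,7), (3,7), (4,7), (6,7), (2,8), (3,8), (4,8), (7,8),
     (2,9), (4,9), (8,9), (2,10), (7,10), (4,11), (9,11), (1,12), (4,12), (0,13), (3,13),
     (3,14), (8,14)]"

text \<open>The infinite graph, each edge directed towards its larger end;
  \<open>counterexample n\<close> is its restriction to the vertices below \<open>n\<close>. The rim
  14, 15, ... is a path joined to the centre 3, where the edge from 3 to 14 belongs to the
  core.\<close>

definition lower_arcs :: "(nat \<times> nat) set" where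
  "lower_arcs = set core_arcs \<union> {(3, m) | m. 15 \<le> m} \<union> {(m, Suc m) | m. 14 \<le> m}"

definition counterexample :: "nat \<Rightarrow> nat pair_pre_digraph" where
  "counterexample n = \<lparr> pverts = {..<n},
     parcs = {(u, v). u < n \<and> v < n \<and> ((u, v) \<in> lower_arcs \<or> (v, u) \<in> lower_arcs)} \<rparr>"

lemma counterexample_verts: "pverts (counterexample n) = {..<n}"
  by (simp add: counterexample_def)

lemma counterexample_arcs_iff:
  "(u, v) \<in> parcs (counterexample n) \<longleftrightarrow>
    u < n \<and> v < n \<and> ((u, v) \<in> lower_arcs \<or> (v, u) \<in> lower_arcs)"
  by (simp add: counterexample_def)

lemma lower_arcs_less: "(u, v) \<in> lower_arcs \<Longrightarrow> u < v"
  by (auto simp: lower_arcs_def core_arcs_def)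

text \<open>A finite check; the quantifiers range over the list of edges so that it can be
  evaluated.\<close>

lemma core_arcs_clique:
  "\<forall>e \<in> set core_arcs. \<forall>f \<in> set core_arcs. snd e = snd f \<and> fst e < fst f \<longrightarrow>
    (fst e, fst f) \<in> set core_arcs"
  by code_simp

lemma lower_arcs_15:
  assumes "(u, w) \<in> lower_arcs" "15 \<le> w"
  shows "u = 3 \<or> w = Suc u"
  using assms by (auto simp: lower_arcs_def core_arcs_def)

text \<open>Below 15 this is the finite check. From 15 on, the only smaller neighbours of
  \<open>w\<close> are 3 and \<open>w - 1\<close>, which are adjacent in the fan.\<close>

lemma lower_arcs_clique:
  assumes "(u, w) \<in> lower_arcs" "(v, w) \<in> lower_arcs" "u < v"
  shows "(u, v) \<in> lower_arcs"
proof (cases "w < 15")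
  case True
  then have "(u, w) \<in> set core_arcs" "(v, w) \<in> set core_arcs"
    using assms by (auto simp: lower_arcs_def)
  then have "(u, v) \<in> set core_arcs"
    using core_arcs_clique[THEN bspec, THEN bspec, of "(u, w)" "(v, w)"] assms(3) by simp
  then show ?thesis
    by (simp add: lower_arcs_def)
next
  case False
  then have "u = 3 \<and> v = w - 1"
    using lower_arcs_15[OF assms(1)] lower_arcs_15[OF assms(2)] assms(3) by auto
  \<comment> \<open>For \<open>w = 15\<close> the required edge joins 3 to 14 and comes from the
    core, not from the fan.\<close>
  moreover have "(3, 14) \<in> set core_arcs"
    by (simp add: core_arcs_def)
  ultimately show ?thesis
    using False by (cases "w = 15") (auto simp: lower_arcs_def)
qed

lemma pair_graph_counterexample: "pair_graph (counterexample n)"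
proof
  show "finite (parcs (counterexample n))"
    by (rule finite_subset[of _ "{..<n} \<times> {..<n}"]) (auto simp: counterexample_def)
  show "symmetric (with_proj (counterexample n))"
    by (auto simp: symmetric_def arcs_ends_def arc_to_ends_def counterexample_def intro!: symI)
qed (auto simp: counterexample_def dest: lower_arcs_less)

lemma chordal_counterexample: "chordal (counterexample n)"
proof (rule chordal_if_elimination_order[OF pair_graph_counterexample])
  fix u v w
  assume "(u, w) \<in> parcs (counterexample n)" "(v, w) \<in> parcs (counterexample n)"
    and *: "u < w" "v < w" "u \<noteq> v"
  then have "(u, w) \<in> lower_arcs" "(v, w) \<in> lower_arcs" "u < n" "v < n"
    by (auto simp: counterexample_def dest: lower_arcs_less)
  moreover have "u < v \<or> v < u"
    using *(3) by linarith
  ultimately have "(u, v) \<in> lower_arcs \<or> (v, u) \<in> lower_arcs"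
    using lower_arcs_clique by blast
  with \<open>u < n\<close> \<open>v < n\<close> show "(u, v) \<in> parcs (counterexample n)"
    by (simp add: counterexample_arcs_iff)
qed

lemma pair_wf_digraph_counterexample: "pair_wf_digraph (counterexample n)"
  using pair_graph_counterexample by (rule pair_wf_digraph_if_pair_graph)

section \<open>Cycles through the whole fan, and Hamiltonicity\<close>

lemma successively_upt:
  assumes "\<And>m. a \<le> m \<Longrightarrow> Suc m < b \<Longrightarrow> P m (Suc m)"
  shows "successively P [a..<b]"
  using assms
proof (induction b)
  case (Suc b)
  have "P (b - 1) b" if "a < b"
    using that Suc.prems by (cases b) auto
  moreover have "successively P [a..<b]"
    using Suc by simp
  ultimately show ?case
    by (cases "a < b") (simp_all add: successively_append_iff)
qed simp

lemma ugraph_cycle_counterexampleI: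
  assumes "distinct vs" "3 \<le> length vs"
    "successively (\<lambda>x y. (x, y) \<in> parcs (counterexample n)) (vs @ [hd vs])"
  shows "ugraph_cycle (counterexample n) (zip vs (rotate1 vs))"
proof -
  have "vs \<noteq> []"
    using assms(2) by auto
  then show ?thesis
    using assms set_zip_rotate1_subset_iff[of vs "parcs (counterexample n)"]
    unfolding ugraph_cycle_iff[OF pair_wf_digraph_counterexample] by blast
qed

lemma lower_arcs_3: "14 \<le> m \<Longrightarrow> (3, m) \<in> lower_arcs"
  by (cases "m = 14") (simp_all add: lower_arcs_def core_arcs_def)

text \<open>The common shape of the Hamiltonian cycle and of the cycle without extension: from 3 to
  the far end of the rim, down the rim to 14, then to 8. Only the segments \<open>xs\<close> and
  \<open>ys\<close>, free of \<open>n\<close>, remain to be checked for each cycle.\<close>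

lemma counterexample_cycle:
  assumes n: "15 \<le> n"
    and xs: "xs \<noteq> []" and ys: "ys \<noteq> []" "hd ys = 8"
    and dist: "distinct (xs @ [3])" "distinct ys" "set (xs @ [3]) \<inter> set ys = {}"
    and less: "\<forall>x \<in> set (xs @ ys). x < 14"
    and succ: "successively (\<lambda>x y. (x, y) \<in> parcs (counterexample n)) (xs @ [3])"
      "successively (\<lambda>x y. (x, y) \<in> parcs (counterexample n)) (ys @ [hd xs])"
  shows "ugraph_cycle (counterexample n)
    (zip (xs @ [3] @ rev [14..<n] @ ys) (rotate1 (xs @ [3] @ rev [14..<n] @ ys)))"
proof (rule ugraph_cycle_counterexampleI)
  show "distinct (xs @ [3] @ rev [14..<n] @ ys)"
    using dist less by (auto simp: Ball_def)
  show "3 \<le> length (xs @ [3] @ rev [14..<n] @ ys)"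
    using n xs ys by (cases xs; cases ys) simp_all
  \<comment> \<open>The rim is traversed downwards, so before \<open>rev\<close> the relation is
    flipped.\<close>
  have "successively (\<lambda>x y. (y, x) \<in> parcs (counterexample n)) [14..<n]"
    by (rule successively_upt) (auto simp: counterexample_arcs_iff lower_arcs_def)
  moreover have "(3, n - 1) \<in> parcs (counterexample n)" "(14, 8) \<in> parcs (counterexample n)"
    using n lower_arcs_3[of "n - 1"]
    by (auto simp: counterexample_arcs_iff) (simp add: lower_arcs_def core_arcs_def)
  ultimately have "successively (\<lambda>x y. (x, y) \<in> parcs (counterexample n))
      ((xs @ [3]) @ rev [14..<n] @ ys @ [hd xs])"
    using n ys succ unfolding successively_append_iff[of _ "xs @ [3]"]
      successively_append_iff[of _ "rev _"]
    by (simp add: hd_rev last_rev)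
  then show "successively (\<lambda>x y. (x, y) \<in> parcs (counterexample n))
      ((xs @ [3] @ rev [14..<n] @ ys) @ [hd (xs @ [3] @ rev [14..<n] @ ys)])"
    using xs by simp
qed

lemma lessThan_split:
  fixes n :: nat
  assumes "15 \<le> n"
  shows "{..<n} = {0,1,2,3,4,5,6,7,8,9,10,11,12,13} \<union> {14..<n}"
proof -
  have "{..<n} = set [0..<14] \<union> {14..<n}"
    using assms by auto
  then show ?thesis
    by (simp add: upt_rec numeral_eq_Suc)
qed

lemma hamiltonian_counterexample:
  assumes "15 \<le> n"
  shows "hamiltonian (counterexample n)"
proof -
  \<comment> \<open>Each of 10, 11, 12, 13 stands between its only two neighbours; 5 and 6 are
    passed on the way from 1 to 7.\<close>
  let ?vs = "[7, 10, 2, 0, 13] @ [3] @ rev [14..<n] @ [8, 9, 11, 4, 12, 1, 5, 6]"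
  have "ugraph_cycle (counterexample n) (zip ?vs (rotate1 ?vs))"
    using assms
    by (intro counterexample_cycle) (auto simp: counterexample_arcs_iff lower_arcs_def core_arcs_def)
  moreover have "set ?vs = {..<n}"
    unfolding lessThan_split[OF assms] by auto
  ultimately show ?thesis
    unfolding hamiltonian_def hamiltonian_cycle_def
    by (intro exI[of _ "zip ?vs (rotate1 ?vs)"] conjI) (simp_all only: cycle_verts_zip counterexample_verts)
qed

section \<open>Forced edges and the cycle without extension\<close>

definition arc_nbrs :: "nat \<Rightarrow> nat set" where
  "arc_nbrs v = {u. (u, v) \<in> lower_arcs \<or> (v, u) \<in> lower_arcs}"

text \<open>Neighbours in the infinite graph, hence the same for all \<open>n\<close>; therefore 14
  has the neighbour 15 here, which is absent when \<open>n = 15\<close>.\<close>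

lemma arc_nbrs:
  "arc_nbrs 5 = {1, 2, 3, 4, 6}"
  "arc_nbrs 6 = {2, 3, 4, 5, 7}"
  "arc_nbrs 7 = {2, 3, 4, 6, 8, 10}"
  "arc_nbrs 9 = {2, 4, 8, 11}"
  "arc_nbrs 10 = {2, 7}"
  "arc_nbrs 11 = {4, 9}"
  "arc_nbrs 12 = {1, 4}"
  "arc_nbrs 13 = {0, 3}"
  "arc_nbrs 14 = {3, 8, 15}"
  by (auto simp: arc_nbrs_def lower_arcs_def core_arcs_def)

lemma not_cycle_extendable_counterexample:
  assumes n: "15 \<le> n"
  shows "\<not> cycle_extendable (counterexample n)"
proof
  let ?G = "counterexample n"
  have wf: "pair_wf_digraph ?G"
    by (rule pair_wf_digraph_counterexample)
  obtain C where C: "ugraph_cycle ?G C" and C_verts: "cycle_verts C = {..<n} - {5, 6}"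
  proof
    \<comment> \<open>Here 1 is followed by 0, and 8 returns directly to 7, so that exactly 5 and 6
      are left out.\<close>
    let ?vs = "[7, 10, 2, 9, 11, 4, 12, 1, 0, 13] @ [3] @ rev [14..<n] @ [8]"
    show "ugraph_cycle ?G (zip ?vs (rotate1 ?vs))"
      using n by (intro counterexample_cycle)
        (auto simp: counterexample_arcs_iff lower_arcs_def core_arcs_def)
    show "cycle_verts (zip ?vs (rotate1 ?vs)) = {..<n} - {5, 6}"
      unfolding cycle_verts_zip lessThan_split[OF n] by auto
  qed
  assume "cycle_extendable ?G"
  moreover have "5 \<in> pverts ?G - cycle_verts C"
    using n by (simp add: C_verts counterexample_verts)
  then have "\<not> hamiltonian_cycle ?G C"
    by (auto simp: hamiltonian_cycle_def)
  ultimately obtain D v where D: "ugraph_cycle ?G D" "length D = length C + 1"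
    and v: "cycle_verts D - cycle_verts C = {v}"
    using C unfolding cycle_extendable_def extendable_def cycle_extension_def by blast
  have "finite (cycle_verts D)"
    by (simp add: cycle_verts_def)
  \<comment> \<open>\<open>D\<close> has one vertex more than \<open>C\<close> and exactly one
    outside \<open>C\<close>, so by counting it loses no vertex of \<open>C\<close>.\<close>
  then have "card (cycle_verts D \<inter> cycle_verts C) = card (cycle_verts C)"
    using card_cycle_verts[OF wf C] card_cycle_verts[OF wf D(1)] D(2)
      card_Int_Diff[of "cycle_verts D" "cycle_verts C"] v by simp
  then have "cycle_verts D \<inter> cycle_verts C = cycle_verts C"
    by (intro card_subset_eq) (auto simp: cycle_verts_def)
  then have D_verts: "cycle_verts D = insert v ({..<n} - {5, 6})"
    using v C_verts by blast
  have "v \<in> {..<n}"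
    using cycle_verts_subset_pverts[OF wf D(1)] v by (auto simp: counterexample_def)
  then have v56: "v = 5 \<or> v = 6"
    using v C_verts by blast

  note nbrs_eq = cycle_nbrs_eq[OF wf D(1)]
  \<comment> \<open>The forcing from below, read from the other ends: a vertex listed in two known
    neighbourhoods is saturated by them.\<close>
  have nbrs_eq': "cycle_nbrs D v = {x, y}"
    if "v \<in> cycle_nbrs D x" "v \<in> cycle_nbrs D y" "x \<noteq> y" for v x y
    using cycle_nbrs_eq'[OF wf D(1), of x v y] that cycle_nbrs_sym[of v D] by simp
  have D_less: "x < n" if "x \<in> cycle_nbrs D y" for x y
    using cycle_nbrs_subset[OF wf D(1)] cycle_verts_subset_pverts[OF wf D(1)] that
    unfolding counterexample_verts by blast
  have D_nbrs: "cycle_nbrs D y \<subseteq> arc_nbrs y" for y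
    using cycle_nbrs_arcs[OF wf D(1)] unfolding counterexample_arcs_iff arc_nbrs_def by blast
  have mem_D: "x \<in> cycle_verts D" if "x < n" "x \<noteq> 5" "x \<noteq> 6" for x
    using D_verts that by simp
  \<comment> \<open>The vertices 10 to 13 have degree 2 and lie on \<open>D\<close>, so both edges
    at each are forced; 11 and 12 together then saturate 4.\<close>
  have N10: "cycle_nbrs D 10 = {2, 7}"
    using n D_nbrs[of 10] by (intro nbrs_eq mem_D) (simp_all add: arc_nbrs)
  have N11: "cycle_nbrs D 11 = {4, 9}"
    using n D_nbrs[of 11] by (intro nbrs_eq mem_D) (simp_all add: arc_nbrs)
  have N12: "cycle_nbrs D 12 = {1, 4}"
    using n D_nbrs[of 12] by (intro nbrs_eq mem_D) (simp_all add: arc_nbrs)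
  have N13: "cycle_nbrs D 13 = {0, 3}"
    using n D_nbrs[of 13] by (intro nbrs_eq mem_D) (simp_all add: arc_nbrs)
  have N4: "cycle_nbrs D 4 = {11, 12}"
    by (rule nbrs_eq') (simp_all add: N11 N12)
  have N14_15: "cycle_nbrs D 14 = {3, 8}" if "n = 15"
    using that D_nbrs[of 14] D_less[of 15 14]
    by (intro nbrs_eq mem_D) (auto simp: arc_nbrs)
  \<comment> \<open>The last rim vertex has degree 2 in the graph, its neighbours being 3 and
    \<open>n - 2\<close>, or 3 and 8 if it is 14. Together with 13 it saturates 3.\<close>
  have "3 \<in> cycle_nbrs D (n - 1)"
  proof (cases "n = 15")
    case True
    then show ?thesis
      using N14_15 by simp
  next
    case False
    have "cycle_nbrs D (n - 1) \<subseteq> {3, n - 2}"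
    proof
      fix x
      assume x: "x \<in> cycle_nbrs D (n - 1)"
      then have "(x, n - 1) \<in> lower_arcs"
        using D_nbrs[of "n - 1"] D_less[OF x] lower_arcs_less[of "n - 1" x]
        by (force simp: arc_nbrs_def)
      moreover have "15 \<le> n - 1"
        using n False by linarith
      ultimately show "x \<in> {3, n - 2}"
        using lower_arcs_15[of x "n - 1"] by auto
    qed
    then have "cycle_nbrs D (n - 1) = {3, n - 2}"
      using n by (intro nbrs_eq mem_D) simp_all
    then show ?thesis
      by simp
  qed
  then have N3: "cycle_nbrs D 3 = {13, n - 1}"
    using n by (intro nbrs_eq') (simp_all add: N13)
  \<comment> \<open>If 14 is not the last rim vertex, its edge to 3 is excluded because 3 is
    saturated, which leaves 8 and 15.\<close>
  have N14: "8 \<in> cycle_nbrs D 14"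
  proof (cases "n = 15")
    case True
    then show ?thesis
      using N14_15 by simp
  next
    case False
    then have "3 \<notin> cycle_nbrs D 14"
      using n by (simp add: cycle_nbrs_sym[of 3 D] N3)
    then have "cycle_nbrs D 14 = {8, 15}"
      using n D_nbrs[of 14] by (intro nbrs_eq mem_D) (auto simp: arc_nbrs)
    then show ?thesis
      by simp
  qed
  from v56 show False
  proof
    assume v: "v = 6"
    have "5 \<notin> cycle_nbrs D 6"
      using cycle_nbrs_subset[OF wf D(1), of 6] D_verts v by auto
    moreover have "3 \<notin> cycle_nbrs D 6" "4 \<notin> cycle_nbrs D 6"
      using n by (simp_all add: cycle_nbrs_sym[of 3 D] cycle_nbrs_sym[of 4 D] N3 N4)
    ultimately have N6: "cycle_nbrs D 6 = {2, 7}"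
      using D_nbrs[of 6] D_verts v by (intro nbrs_eq) (auto simp: arc_nbrs)
    \<comment> \<open>Both 2 and 7 lie next to 6 and to 10, so \<open>D\<close> would be a 4-cycle,
      yet it contains 0.\<close>
    have N2: "cycle_nbrs D 2 = {6, 10}" and N7: "cycle_nbrs D 7 = {6, 10}"
      by (rule nbrs_eq'; simp add: N6 N10)+
    have "6 \<in> cycle_verts D"
      using D_verts v by simp
    moreover have "cycle_nbrs D u \<subseteq> {2, 6, 7, 10}" if "u \<in> {2, 6, 7, 10}" for u
      using that N2 N6 N7 N10 by (elim insertE) simp_all
    ultimately have "cycle_verts D \<subseteq> {2, 6, 7, 10}"
      using cycle_verts_subset_closed[OF wf D(1), of 6 "{2, 6, 7, 10}"] by simp
    moreover have "0 \<in> cycle_verts D"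
      using n by (intro mem_D) simp_all
    ultimately show False
      by auto
  next
    assume v: "v = 5"
    have 6: "6 \<notin> cycle_nbrs D y" for y
      using cycle_nbrs_subset[OF wf D(1), of y] D_verts v by auto
    have "3 \<notin> cycle_nbrs D 5" "4 \<notin> cycle_nbrs D 5"
      using n by (simp_all add: cycle_nbrs_sym[of 3 D] cycle_nbrs_sym[of 4 D] N3 N4)
    then have N5: "cycle_nbrs D 5 = {1, 2}"
      using 6 D_nbrs[of 5] D_verts v by (intro nbrs_eq) (auto simp: arc_nbrs)
    have N2: "cycle_nbrs D 2 = {5, 10}"
      by (rule nbrs_eq') (simp_all add: N5 N10)
    \<comment> \<open>With 2 and 4 saturated, 9 keeps only 8 and 11; then 9 and 14 saturate 8, which
      removes the edge from 7 to 8.\<close>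
    have "2 \<notin> cycle_nbrs D 9" "4 \<notin> cycle_nbrs D 9"
      by (simp_all add: cycle_nbrs_sym[of 2 D] cycle_nbrs_sym[of 4 D] N2 N4)
    then have N9: "cycle_nbrs D 9 = {8, 11}"
      using n D_nbrs[of 9] by (intro nbrs_eq mem_D) (auto simp: arc_nbrs)
    have N8: "cycle_nbrs D 8 = {9, 14}"
      using N14 by (intro nbrs_eq') (simp_all add: N9)
    have "2 \<notin> cycle_nbrs D 7" "3 \<notin> cycle_nbrs D 7" "4 \<notin> cycle_nbrs D 7" "8 \<notin> cycle_nbrs D 7"
      using n by (simp_all add: cycle_nbrs_sym[of 2 D] cycle_nbrs_sym[of 3 D]
          cycle_nbrs_sym[of 4 D] cycle_nbrs_sym[of 8 D] N2 N3 N4 N8)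
    then have "cycle_nbrs D 7 \<subseteq> {10}"
      using 6 D_nbrs[of 7] by (auto simp: arc_nbrs)
    moreover have "card (cycle_nbrs D 7) = 2"
      using n by (intro card_cycle_nbrs[OF wf D(1)] mem_D) simp_all
    ultimately show False
      using card_mono[of "{10}" "cycle_nbrs D 7"] by simp
  qed
qed

theorem theorem2p2:
  fixes n :: nat
  assumes "n \<ge> 15"
  shows "\<exists>G :: nat pair_pre_digraph. pair_graph G \<and> card (pverts G) = n \<and>
    hamiltonian G \<and> chordal G \<and> \<not> fully_cycle_extendable G"
proof (intro exI conjI)
  show "card (pverts (counterexample n)) = n"
    by (simp add: counterexample_def)
  show "\<not> fully_cycle_extendable (counterexample n)"
    using not_cycle_extendable_counterexample[OF assms] by (simp add: fully_cycle_extendable_def)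
qed (fact pair_graph_counterexample hamiltonian_counterexample[OF assms] chordal_counterexample)+

end
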